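(* Let $G$ be a classical knot shadow with no Reidemeister-I curl and with $s>3$ crossings. Let $D$ be a diagram on $G$ and let $D'$ be another diagram on $G$ (so $D'\neq D$). Then $D$ can be transformed into $D'$ by a (finite) sequence of arc crossing changes if and only if both of the following hold: (1) $D$ and $D'$ have the same state parity; and (2) $D'$ is not a source.
   Context: Shadow. A classical knot shadow is the image $G\subset\mathbb R^2$ of a generic immersion $\gamma:S^1\to\mathbb R^2$ of a single circle whose only singularities are finitely many transverse double points, called crossings, denoted $x_0,\dots,x_{s-1}$ (crossing $x_i$ is also referred to by its label $i$). Each crossing $x_i$ has exactly two preimages in $S^1$, called its two occurrences; there are $2s$ occurrences in total. Orient $S^1$ and fix a basepoint that is not an occurrence; traversing $S^1$ from the basepoint, the first-met preimage of $x_i$ is called the first occurrence $p_i^0$ and the other the second occurrence $p_i^1$. Reading the labels of the $2s$ occurrences in order gives the cyclic occurrence word (Gauss word) $W=w_0\cdots w_{2s-1}$, in which every label occurs twice. $G$ has no Reidemeister-I curl (is R1-reduced) if no two cyclically adjacent letters of $W$ are equal. Diagrams. A diagram on $G$ is a choice, for every crossing, of one of its two occurrences as the undercrossing occurrence (the other is then the overcrossing occurrence). The state parity of a diagram is the parity (mod 2) of the number of crossings at which the second occurrence is chosen as the undercrossing occurrence. Arc crossing change (Cericola's version). The $s$ undercrossing occurrences of a diagram cut the oriented circle $S^1$ into $s$ arcs, each running from one undercrossing occurrence to the next one in the cyclic order. An arc crossing change on an arc whose endpoints are the undercrossing occurrences of crossings $i$ and $j$ switches over/under at crossings $i$ and $j$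 and leaves all other crossings unchanged. Source. A diagram on $G$ is a source if no other diagram on $G$ can be changed into it by one arc crossing change. *)

theory Defs
  imports "HOL-Analysis.Analysis"
begin

text \<open>
  The circle is the unit circle of the complex plane, oriented counterclockwise (the other
  orientation is obtained by precomposing the curve with complex conjugation). A shadow is given
  by a parametrizing immersion \<open>\<gamma>\<close>, and a crossing is labelled by the double point itself.
\<close>

abbreviation circle :: "complex set" where
  "circle \<equiv> sphere 0 1"

definition tangent :: "(complex \<Rightarrow> real^2) \<Rightarrow> complex \<Rightarrow> real^2" where
  "tangent \<gamma> p = vector_derivative (\<lambda>t. \<gamma> (p * cis t)) (at 0)"

definition immersion :: "(complex \<Rightarrow> real^2) \<Rightarrow> bool" where
  "immersion \<gamma> \<longleftrightarrow>
     (\<lambda>t. \<gamma> (cis t)) C1_differentiable_on UNIV \<and> (\<forall>p\<in>circle. tangent \<gamma> p \<noteq> 0)"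

definition preimages :: "(complex \<Rightarrow> real^2) \<Rightarrow> real^2 \<Rightarrow> complex set" where
  "preimages \<gamma> x = {p \<in> circle. \<gamma> p = x}"

definition crossings :: "(complex \<Rightarrow> real^2) \<Rightarrow> (real^2) set" where
  "crossings \<gamma> = {x. \<exists>p\<in>preimages \<gamma> x. \<exists>q\<in>preimages \<gamma> x. p \<noteq> q}"

definition occurrences :: "(complex \<Rightarrow> real^2) \<Rightarrow> complex set" where
  "occurrences \<gamma> = {p \<in> circle. \<gamma> p \<in> crossings \<gamma>}"

definition knot_shadow :: "(complex \<Rightarrow> real^2) \<Rightarrow> bool" where
  "knot_shadow \<gamma> \<longleftrightarrow>
     immersion \<gamma> \<and> finite (crossings \<gamma>) \<and>
     (\<forall>x\<in>crossings \<gamma>. card (preimages \<gamma> x) = 2) \<and>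
     (\<forall>p\<in>circle. \<forall>q\<in>circle. p \<noteq> q \<and> \<gamma> p = \<gamma> q \<longrightarrow>
        \<not> collinear {0, tangent \<gamma> p, tangent \<gamma> q})"

definition basepoint :: "(complex \<Rightarrow> real^2) \<Rightarrow> complex \<Rightarrow> bool" where
  "basepoint \<gamma> b \<longleftrightarrow> b \<in> circle \<and> b \<notin> occurrences \<gamma>"

text \<open>For points of the circle, the length in \<open>[0, 2\<pi>)\<close> of the oriented path from \<open>p\<close> to \<open>q\<close>.\<close>

definition travel :: "complex \<Rightarrow> complex \<Rightarrow> real" where
  "travel p q = Arg2pi (q / p)"

definition gauss_word :: "(complex \<Rightarrow> real^2) \<Rightarrow> complex \<Rightarrow> (real^2) list" where
  "gauss_word \<gamma> b = map \<gamma> (sorted_key_list_of_set (travel b) (occurrences \<gamma>))"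

definition R1_reduced :: "(complex \<Rightarrow> real^2) \<Rightarrow> complex \<Rightarrow> bool" where
  "R1_reduced \<gamma> b \<longleftrightarrow>
     (let W = gauss_word \<gamma> b
      in \<forall>k<length W. W ! k \<noteq> W ! (Suc k mod length W))"

definition second_occurrences :: "(complex \<Rightarrow> real^2) \<Rightarrow> complex \<Rightarrow> complex set" where
  "second_occurrences \<gamma> b =
     {p \<in> occurrences \<gamma>. \<exists>q\<in>occurrences \<gamma>. \<gamma> q = \<gamma> p \<and> travel b q < travel b p}"

text \<open>A diagram assigns to each crossing its undercrossing occurrence.\<close>

definition diagrams :: "(complex \<Rightarrow> real^2) \<Rightarrow> (real^2 \<Rightarrow> complex) set" where
  "diagrams \<gamma> = Pi\<^sub>E (crossings \<gamma>) (preimages \<gamma>)"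

definition state_parity ::
  "(complex \<Rightarrow> real^2) \<Rightarrow> complex \<Rightarrow> (real^2 \<Rightarrow> complex) \<Rightarrow> nat" where
  "state_parity \<gamma> b D = card {x \<in> crossings \<gamma>. D x \<in> second_occurrences \<gamma> b} mod 2"

definition other_occurrence :: "(complex \<Rightarrow> real^2) \<Rightarrow> complex \<Rightarrow> complex" where
  "other_occurrence \<gamma> p = (THE q. q \<in> occurrences \<gamma> \<and> \<gamma> q = \<gamma> p \<and> q \<noteq> p)"

definition switch_at ::
  "(complex \<Rightarrow> real^2) \<Rightarrow> (real^2) set \<Rightarrow> (real^2 \<Rightarrow> complex) \<Rightarrow> (real^2 \<Rightarrow> complex)" where
  "switch_at \<gamma> X D =
     (\<lambda>x\<in>crossings \<gamma>. if x \<in> X then other_occurrence \<gamma> (D x) else D x)"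

text \<open>
  The arc of \<open>D\<close> starting at the undercrossing occurrence \<open>p\<close> ends at \<open>q\<close>. With a single
  crossing the only arc is closed; this degenerate case is excluded by \<open>p \<noteq> q\<close>.
\<close>

definition is_arc ::
  "(complex \<Rightarrow> real^2) \<Rightarrow> (real^2 \<Rightarrow> complex) \<Rightarrow> complex \<Rightarrow> complex \<Rightarrow> bool" where
  "is_arc \<gamma> D p q \<longleftrightarrow>
     p \<in> D ` crossings \<gamma> \<and> q \<in> D ` crossings \<gamma> \<and> p \<noteq> q \<and>
     (\<forall>r\<in>D ` crossings \<gamma>. r \<noteq> p \<longrightarrow> travel p q \<le> travel p r)"

definition arc_crossing_change ::
  "(complex \<Rightarrow> real^2) \<Rightarrow> (real^2 \<Rightarrow> complex) \<Rightarrow> (real^2 \<Rightarrow> complex) \<Rightarrow> bool" where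
  "arc_crossing_change \<gamma> D D' \<longleftrightarrow>
     D \<in> diagrams \<gamma> \<and> (\<exists>p q. is_arc \<gamma> D p q \<and> D' = switch_at \<gamma> {\<gamma> p, \<gamma> q} D)"

definition is_source :: "(complex \<Rightarrow> real^2) \<Rightarrow> (real^2 \<Rightarrow> complex) \<Rightarrow> bool" where
  "is_source \<gamma> D \<longleftrightarrow>
     D \<in> diagrams \<gamma> \<and> \<not> (\<exists>E\<in>diagrams \<gamma>. E \<noteq> D \<and> arc_crossing_change \<gamma> E D)"

end

theory Submission
  imports Defs
begin

text \<open>
  Parity is invariant because an arc crossing change switches exactly two crossings, and the last
  nontrivial change of a sequence exhibits a predecessor of its result; this is one direction.

  For the converse let \<open>T\<close> be a diagram with a predecessor and let \<open>\<B>\<close> be the set of diagrams from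
  which \<open>T\<close> can be reached. This set contains every predecessor of each of its members, and none of
  its members \<open>W\<close> is isolated: some diagram differing from \<open>W\<close> in exactly two crossings is again in
  \<open>\<B>\<close>, namely a predecessor of \<open>T\<close> if \<open>W = T\<close>, and the first diagram on a path from \<open>W\<close> to \<open>T\<close>
  otherwise. The heart of the proof (\<open>predecessor_closed_imp_flip_closed\<close>) is that these two
  properties force \<open>\<B>\<close> to be closed under flipping two arbitrary crossings. Flipping pairs reaches
  all diagrams of the same parity, so all of them lie in \<open>\<B>\<close>.

  The argument for closure fixes \<open>W\<close> in \<open>\<B>\<close> and looks at two relations on crossings. Call \<open>x\<close> and
  \<open>y\<close> separated if flipping both leaves \<open>\<B>\<close>. Let \<open>x\<close> lead to \<open>y\<close> if, after the undercrossing of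
  \<open>x\<close> has been moved to its other occurrence, it is next to the undercrossing of \<open>y\<close>. The key
  transfer rule (\<open>separated_leads\<close>) says that if \<open>k\<close> leads to \<open>e\<close>, every crossing \<open>c \<noteq> e\<close>
  separated from \<open>k\<close> is separated from \<open>e\<close>: the diagram with \<open>k\<close> and \<open>c\<close> flipped lies outside
  \<open>\<B>\<close>, hence so do its successors, and switching the arc between \<open>k\<close> and \<open>e\<close> turns it into the
  diagram with \<open>c\<close> and \<open>e\<close> flipped. The undercrossing of \<open>c\<close> cannot obstruct that arc, since then
  switching \<open>k\<close> and \<open>c\<close> would lead back to \<open>W\<close>.

  If flipping some pair does leave \<open>\<B>\<close>, then \<open>W\<close> can be chosen so that some crossing leads to one
  from which it is separated. By the transfer rule, closed neighbourhoods in the separation graph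
  grow along such steps, and after one such step all further steps are of the same kind. Where the
  neighbourhood has become as large as possible, it stays constant, and the crossings that have
  this neighbourhood and lead only to crossings separated from them form a set \<open>R\<close> that is closed
  under leading and pairwise separated. If \<open>R\<close> is not
  the set of all crossings, a pigeonhole argument (\<open>neighbours_in_closed_set\<close>) finds two crossings
  of \<open>R\<close> whose overcrossings lie in the same gap between undercrossings of \<open>W\<close>. Flipping them
  gives a predecessor of \<open>W\<close>, which is in \<open>\<B>\<close> although the two crossings are separated. So \<open>R\<close>
  consists of all crossings, and \<open>W\<close> is isolated, a contradiction.
\<close>

section \<open>Cyclic order of points on the circle\<close>

definition open_arc :: "complex \<Rightarrow> complex \<Rightarrow> complex set" where
  "open_arc p q = {r \<in> circle. 0 < travel p r \<and> travel p r < travel p q}"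

lemma travel_conv_Arg2pi:
  assumes "p \<in> circle" "q \<in> circle"
  shows "travel p q =
    (if Arg2pi p \<le> Arg2pi q then Arg2pi q - Arg2pi p else Arg2pi q - Arg2pi p + 2 * pi)"
proof -
  have "p \<noteq> 0" "q \<noteq> 0"
    using assms by auto
  then show ?thesis
    using Arg2pi_diff[of q p] by (auto simp: travel_def split: if_splits)
qed

lemma Arg2pi_inj_circle:
  assumes "p \<in> circle" "q \<in> circle" "Arg2pi p = Arg2pi q"
  shows "p = q"
  using assms Arg2pi_eq[of p] Arg2pi_eq[of q] by simp

lemma travel_self [simp]: "p \<in> circle \<Longrightarrow> travel p p = 0"
  by (simp add: travel_conv_Arg2pi)

lemma travel_pos:
  assumes "p \<in> circle" "q \<in> circle" "p \<noteq> q"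
  shows "0 < travel p q"
proof -
  have "Arg2pi p \<noteq> Arg2pi q"
    using assms Arg2pi_inj_circle by blast
  then show ?thesis
    using assms Arg2pi_ge_0[of q] Arg2pi_lt_2pi[of p] by (auto simp: travel_conv_Arg2pi)
qed

lemma travel_inj:
  assumes "p \<in> circle" "q \<in> circle" "r \<in> circle" "travel p q = travel p r"
  shows "q = r"
  using assms Arg2pi_inj_circle[of q r] Arg2pi_ge_0[of q] Arg2pi_lt_2pi[of q] 
    Arg2pi_ge_0[of r] Arg2pi_lt_2pi[of r] 
  by (auto simp: travel_conv_Arg2pi split: if_splits)

lemma mem_open_arc_iff:
  assumes "p \<in> circle" "q \<in> circle" "r \<in> circle"
  shows "r \<in> open_arc p q \<longleftrightarrow> r \<noteq> p \<and> r \<noteq> q \<and> travel p r + travel r q = travel p q"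
proof (cases "r = p \<or> r = q")
  case True
  then show ?thesis using assms by (auto simp: open_arc_def)
next
  case False
  then have "Arg2pi r \<noteq> Arg2pi p" "Arg2pi r \<noteq> Arg2pi q"
    using assms Arg2pi_inj_circle by blast+
  with False show ?thesis
    using assms Arg2pi_ge_0[of q] Arg2pi_lt_2pi[of q] 
    Arg2pi_ge_0[of r] Arg2pi_lt_2pi[of r] Arg2pi_ge_0[of p] Arg2pi_lt_2pi[of p] 
    by (auto simp: open_arc_def travel_conv_Arg2pi split: if_splits)
qed

lemma endpoints_notin_open_arc [simp]:
  assumes "p \<in> circle"
  shows "p \<notin> open_arc p q" "q \<notin> open_arc p q"
  using assms by (auto simp: open_arc_def)

lemma travel_less_left:
  assumes "r \<in> open_arc p q" 
  shows "travel p r < travel p q"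
  using assms by (simp add: open_arc_def)

lemma travel_less_right:
  assumes "p \<in> circle" "q \<in> circle" "r \<in> open_arc p q" 
  shows "travel r q < travel p q"
  using assms mem_open_arc_iff[of p q r] travel_pos[of p r] by (auto simp: open_arc_def)

lemma open_arc_initial:
  assumes "r \<in> open_arc p q"
  shows "open_arc p r \<subseteq> open_arc p q"
  using assms by (auto simp: open_arc_def)

lemma open_arc_final:
  assumes "p \<in> circle" "q \<in> circle" "r \<in> open_arc p q"
  shows "open_arc r q \<subseteq> open_arc p q"
proof
  fix t assume t: "t \<in> open_arc r q"
  have c: "r \<in> circle" "t \<in> circle"
    using assms t by (auto simp: open_arc_def)
  have "travel p r + travel r t < 2 * pi" 
    using t assms c mem_open_arc_iff[of p q r] travel_pos[of p r] Arg2pi_lt_2pi[of "q/p"]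
    by (auto simp: open_arc_def travel_def)
  then have "travel p t = travel p r + travel r t"
    using assms c Arg2pi_ge_0[of t] Arg2pi_lt_2pi[of t] 
    Arg2pi_ge_0[of r] Arg2pi_lt_2pi[of r] Arg2pi_ge_0[of p] Arg2pi_lt_2pi[of p] 
    by (auto simp: travel_conv_Arg2pi split: if_splits)
  then show "t \<in> open_arc p q"
    using t assms c mem_open_arc_iff[of p q r] travel_pos[of p r] by (auto simp: open_arc_def)
qed

text \<open>Going backwards from \<open>r\<close>, one of \<open>p\<close> and \<open>q\<close> is met first.\<close>

lemma open_arc_dichotomy:
  assumes "p \<in> circle" "q \<in> circle" "r \<in> circle" "p \<noteq> q" "p \<noteq> r" "q \<noteq> r"
  shows "q \<in> open_arc p r \<or> p \<in> open_arc q r"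
proof -
  have "Arg2pi q \<noteq> Arg2pi p" "Arg2pi q \<noteq> Arg2pi r" "Arg2pi p \<noteq> Arg2pi r"
    using assms Arg2pi_inj_circle by blast+
  then show ?thesis
    using assms Arg2pi_ge_0[of q] Arg2pi_lt_2pi[of q] 
    Arg2pi_ge_0[of r] Arg2pi_lt_2pi[of r] Arg2pi_ge_0[of p] Arg2pi_lt_2pi[of p] 
    by (auto simp: open_arc_def travel_conv_Arg2pi split: if_splits)
qed

section \<open>Diagrams and flips\<close>

text \<open>
  The combinatorial content of a shadow: the cyclic order of its occurrences on the circle, and
  their pairing into crossings.
\<close>

locale double_points =
  fixes \<gamma> :: "complex \<Rightarrow> real^2"
  assumes finite_crossings: "finite (crossings \<gamma>)"
    and card_preimages: "x \<in> crossings \<gamma> \<Longrightarrow> card (preimages \<gamma> x) = 2"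
begin

abbreviation "X \<equiv> crossings \<gamma>"
abbreviation "flip \<equiv> switch_at \<gamma>"
abbreviation "over D x \<equiv> other_occurrence \<gamma> (D x)"

lemma preimages_occurrences: "x \<in> X \<Longrightarrow> p \<in> preimages \<gamma> x \<Longrightarrow> p \<in> occurrences \<gamma>"
  by (auto simp: preimages_def occurrences_def)

lemma other_occurrence_eq:
  assumes "x \<in> X" "preimages \<gamma> x = {p, q}" "p \<noteq> q"
  shows "other_occurrence \<gamma> p = q"
  unfolding other_occurrence_def
proof (rule the_equality)
  have "p \<in> preimages \<gamma> x" "q \<in> preimages \<gamma> x"
    using assms by auto
  then show "q \<in> occurrences \<gamma> \<and> \<gamma> q = \<gamma> p \<and> q \<noteq> p"
    using assms preimages_occurrences by (auto simp: preimages_def)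
next
  fix r assume "r \<in> occurrences \<gamma> \<and> \<gamma> r = \<gamma> p \<and> r \<noteq> p"
  moreover have "\<gamma> p = x"
    using assms(2) by (auto simp: preimages_def)
  ultimately have "r \<in> preimages \<gamma> x" "r \<noteq> p"
    by (auto simp: preimages_def occurrences_def)
  then show "r = q"
    using assms by auto
qed

lemma preimages_under_over:
  assumes "D \<in> diagrams \<gamma>" "x \<in> X"
  shows "preimages \<gamma> x = {D x, over D x}" "over D x \<noteq> D x" "other_occurrence \<gamma> (over D x) = D x"
proof -
  have "D x \<in> preimages \<gamma> x"
    using assms by (auto simp: diagrams_def)
  moreover obtain p q where "preimages \<gamma> x = {p, q}" "p \<noteq> q"
    using card_preimages[OF assms(2)] by (meson card_2_iff)
  ultimately obtain q where q: "preimages \<gamma> x = {D x, q}" "D x \<noteq> q"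
    by auto
  then have "over D x = q" "other_occurrence \<gamma> q = D x"
    using other_occurrence_eq[OF assms(2)] by (auto simp: insert_commute)
  with q show "preimages \<gamma> x = {D x, over D x}" "over D x \<noteq> D x"
    "other_occurrence \<gamma> (over D x) = D x" by auto
qed

lemma under_over_circle:
  assumes "D \<in> diagrams \<gamma>" "x \<in> X"
  shows "D x \<in> circle" "over D x \<in> circle" "\<gamma> (D x) = x" "\<gamma> (over D x) = x"
proof -
  have "D x \<in> preimages \<gamma> x" "over D x \<in> preimages \<gamma> x"
    using preimages_under_over[OF assms] by auto
  then show "D x \<in> circle" "over D x \<in> circle" "\<gamma> (D x) = x" "\<gamma> (over D x) = x"
    by (auto simp: preimages_def)
qed

lemma flip_apply: "x \<in> X \<Longrightarrow> flip S D x = (if x \<in> S then over D x else D x)"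
  by (simp add: switch_at_def)

lemma flip_diagram [simp]:
  assumes "D \<in> diagrams \<gamma>"
  shows "flip S D \<in> diagrams \<gamma>"
  unfolding diagrams_def
proof (rule PiE_I)
  fix x assume "x \<in> X"
  then show "flip S D x \<in> preimages \<gamma> x"
    using preimages_under_over(1)[OF assms] by (auto simp: flip_apply)
qed (simp add: switch_at_def)

lemma diagram_eqI:
  assumes "D \<in> diagrams \<gamma>" "E \<in> diagrams \<gamma>" "\<And>x. x \<in> X \<Longrightarrow> D x = E x"
  shows "D = E"
  using assms unfolding diagrams_def by (rule PiE_ext)

lemma flip_flip:
  assumes "D \<in> diagrams \<gamma>"
  shows "flip S (flip U D) = flip (sym_diff S U) D"
  by (rule diagram_eqI) (use assms preimages_under_over(3)[OF assms] in \<open>auto simp: flip_apply\<close>)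

lemma flip_empty:
  assumes "D \<in> diagrams \<gamma>"
  shows "flip {} D = D"
  by (rule diagram_eqI) (use assms in \<open>auto simp: flip_apply\<close>)

lemma flip_twice:
  assumes "D \<in> diagrams \<gamma>"
  shows "flip S (flip S D) = D"
  using assms by (simp add: flip_flip flip_empty)

lemma flip_neq:
  assumes "D \<in> diagrams \<gamma>" "x \<in> S" "x \<in> X"
  shows "flip S D \<noteq> D"
  using preimages_under_over(2)[OF assms(1,3)] assms flip_apply[of x S D] by auto

lemma flip_difference:
  assumes "D \<in> diagrams \<gamma>" "E \<in> diagrams \<gamma>"
  shows "E = flip {x \<in> X. D x \<noteq> E x} D"
proof (rule diagram_eqI)
  fix x assume x: "x \<in> X"
  have "E x \<in> preimages \<gamma> x"
    using assms x by (auto simp: diagrams_def)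
  then show "E x = flip {x \<in> X. D x \<noteq> E x} D x"
    using x preimages_under_over(1)[OF assms(1) x] by (auto simp: flip_apply)
qed (use assms in auto)

section \<open>State parity\<close>

text \<open>
  Of the two occurrences of a crossing, exactly the one further from the basepoint is second.
\<close>

lemma second_occurrence_flip:
  assumes "b \<in> circle" "D \<in> diagrams \<gamma>" "x \<in> X"
  shows "over D x \<in> second_occurrences \<gamma> b \<longleftrightarrow> D x \<notin> second_occurrences \<gamma> b"
proof -
  note pre = preimages_under_over[OF assms(2,3)] and c = under_over_circle[OF assms(2,3)]
  have occ: "D x \<in> occurrences \<gamma>" "over D x \<in> occurrences \<gamma>"
    using preimages_occurrences[OF assms(3)] pre(1) by auto
  have only: "q = D x \<or> q = over D x" if "q \<in> occurrences \<gamma>" "\<gamma> q = x" for q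
  proof -
    have "q \<in> preimages \<gamma> x"
      using that by (auto simp: occurrences_def preimages_def)
    then show ?thesis
      using pre(1) by auto
  qed
  have ne: "travel b (D x) \<noteq> travel b (over D x)"
    using travel_inj[OF assms(1) c(1,2)] pre(2) by auto
  have "over D x \<in> second_occurrences \<gamma> b \<longleftrightarrow> travel b (D x) < travel b (over D x)"
    using occ only c by (force simp: second_occurrences_def)
  moreover have "D x \<in> second_occurrences \<gamma> b \<longleftrightarrow> travel b (over D x) < travel b (D x)"
    using occ only c by (force simp: second_occurrences_def)
  ultimately show ?thesis
    using ne by auto
qed

lemma even_card_sym_diff:
  assumes "finite A" "finite B"
  shows "even (card (sym_diff A B)) \<longleftrightarrow> card A mod 2 = card B mod 2"
proof -
  have "card A = card (A - B) + card (A \<inter> B)"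
    by (metis assms(1) card_Diff_subset_Int card_mono add.commute finite_Int inf_le1 le_add_diff_inverse)
  moreover have "card B = card (B - A) + card (A \<inter> B)"
    by (metis assms(2) card_Diff_subset_Int card_mono add.commute finite_Int inf_commute inf_le1 le_add_diff_inverse)
  moreover have "card (sym_diff A B) = card (A - B) + card (B - A)"
    using assms by (intro card_Un_disjoint) auto
  ultimately show ?thesis
    by presburger
qed

lemma state_parity_flip:
  assumes "b \<in> circle" "D \<in> diagrams \<gamma>" "S \<subseteq> X"
  shows "state_parity \<gamma> b (flip S D) = state_parity \<gamma> b D \<longleftrightarrow> even (card S)"
proof -
  let ?U = "\<lambda>D. {x \<in> X. D x \<in> second_occurrences \<gamma> b}"
  have "?U (flip S D) = sym_diff S (?U D)"
    using second_occurrence_flip[OF assms(1,2)] assms(3) by (auto simp: flip_apply split: if_splits)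
  then have "sym_diff (?U (flip S D)) (?U D) = S"
    by auto
  then show ?thesis
    using even_card_sym_diff[of "?U (flip S D)" "?U D"] finite_crossings
    by (simp add: state_parity_def)
qed

section \<open>Neighbouring undercrossings\<close>

definition consecutive :: "(real^2 \<Rightarrow> complex) \<Rightarrow> real^2 \<Rightarrow> real^2 \<Rightarrow> bool" where
  "consecutive D x y \<longleftrightarrow> x \<in> X \<and> y \<in> X \<and> x \<noteq> y \<and> (\<forall>z\<in>X. D z \<notin> open_arc (D x) (D y))"

definition neighbours :: "(real^2 \<Rightarrow> complex) \<Rightarrow> real^2 \<Rightarrow> real^2 \<Rightarrow> bool" where
  "neighbours D x y \<longleftrightarrow> consecutive D x y \<or> consecutive D y x"

lemma is_arc_iff_consecutive:
  assumes "D \<in> diagrams \<gamma>" "x \<in> X" "y \<in> X"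
  shows "is_arc \<gamma> D (D x) (D y) \<longleftrightarrow> consecutive D x y"
proof -
  have inj: "D u = D v \<longleftrightarrow> u = v" if "u \<in> X" "v \<in> X" for u v
    using under_over_circle(3)[OF assms(1)] that by metis
  have "D z \<notin> open_arc (D x) (D y) \<longleftrightarrow> (z \<noteq> x \<longrightarrow> travel (D x) (D y) \<le> travel (D x) (D z))"
    if "z \<in> X" for z
    using that under_over_circle(1)[OF assms(1)] assms travel_pos[of "D x" "D z"] inj
    by (auto simp: open_arc_def)
  then show ?thesis
    using assms inj by (auto simp: is_arc_def consecutive_def)
qed

lemma arc_crossing_change_iff:
  assumes "D \<in> diagrams \<gamma>"
  shows "arc_crossing_change \<gamma> D E \<longleftrightarrow> (\<exists>x y. neighbours D x y \<and> E = flip {x, y} D)"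
proof
  assume "arc_crossing_change \<gamma> D E"
  then obtain p q where pq: "is_arc \<gamma> D p q" "E = flip {\<gamma> p, \<gamma> q} D"
    by (auto simp: arc_crossing_change_def)
  then obtain x y where "x \<in> X" "y \<in> X" "p = D x" "q = D y"
    by (auto simp: is_arc_def)
  with pq show "\<exists>x y. neighbours D x y \<and> E = flip {x, y} D"
    using is_arc_iff_consecutive[OF assms] under_over_circle(3)[OF assms]
    by (auto simp: neighbours_def)
next
  assume "\<exists>x y. neighbours D x y \<and> E = flip {x, y} D"
  then obtain x y where xy: "consecutive D x y" "E = flip {x, y} D"
    by (auto simp: neighbours_def insert_commute)
  then have "x \<in> X" "y \<in> X"
    by (auto simp: consecutive_def)
  with xy show "arc_crossing_change \<gamma> D E"
    using assms is_arc_iff_consecutive[OF assms] under_over_circle(3)[OF assms]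
    unfolding arc_crossing_change_def by metis
qed

lemma neighboursD: "neighbours D x y \<Longrightarrow> x \<in> X \<and> y \<in> X \<and> x \<noteq> y"
  by (auto simp: neighbours_def consecutive_def)

text \<open>
  Switching a crossing \<open>c\<close> removes one undercrossing and inserts another. The removal cannot make
  an empty arc nonempty, and an inserted undercrossing that lands on the arc is the only one there,
  so it is adjacent to both ends.
\<close>

lemma consecutive_flip_other:
  assumes D: "D \<in> diagrams \<gamma>" and xy: "consecutive D x y" and c: "c \<in> X" "c \<noteq> x" "c \<noteq> y"
  defines "E \<equiv> flip {c} D"
  shows "consecutive E x y \<or> consecutive E x c \<and> consecutive E c y"
proof -
  have X: "x \<in> X" "y \<in> X" "x \<noteq> y"
    using xy by (auto simp: consecutive_def)
  have E: "E c = over D c" "z \<in> X \<Longrightarrow> z \<noteq> c \<Longrightarrow> E z = D z" for z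
    using c by (auto simp: E_def flip_apply)
  have free: "D z \<notin> open_arc (D x) (D y)" if "z \<in> X" for z
    using xy that by (auto simp: consecutive_def)
  have circ: "D x \<in> circle" "D y \<in> circle" "E c \<in> circle"
    using under_over_circle[OF D] X c E by auto
  show ?thesis
  proof (cases "E c \<in> open_arc (D x) (D y)")
    case False
    then have "E z \<notin> open_arc (E x) (E y)" if "z \<in> X" for z
      using E X c free that by (cases "z = c") auto
    then show ?thesis
      using X by (auto simp: consecutive_def)
  next
    case True
    have "E z \<notin> open_arc (D x) (E c)" "E z \<notin> open_arc (E c) (D y)" if "z \<in> X" for z
      using E(2) free[OF that] that open_arc_initial[OF True] open_arc_final[OF circ(1,2) True] circ
      by (cases "z = c"; auto)+
    then show ?thesis
      using X E c by (auto simp: consecutive_def)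
  qed
qed

lemma neighbours_flip_other:
  assumes "D \<in> diagrams \<gamma>" "neighbours D x y" "c \<in> X" "c \<noteq> x" "c \<noteq> y"
  shows "neighbours (flip {c} D) x y \<or> neighbours (flip {c} D) x c"
  using assms consecutive_flip_other unfolding neighbours_def by blast

text \<open>
  Going around the circle, one must enter \<open>U\<close> somewhere: among all paths from outside \<open>U\<close>
  into \<open>U\<close>, a shortest one has no undercrossing in its interior.
\<close>

lemma neighbours_on_boundary:
  assumes D: "D \<in> diagrams \<gamma>" and U: "U \<subseteq> X" "U \<noteq> {}" "U \<noteq> X"
  obtains u v where "u \<in> U" "v \<in> X - U" "consecutive D v u"
proof -
  have fin: "finite ((X - U) \<times> U)" and ne: "(X - U) \<times> U \<noteq> {}"
    using U finite_crossings finite_subset[OF U(1)] by auto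
  obtain v u where vu: "(v, u) \<in> (X - U) \<times> U"
    and min: "\<And>v' u'. (v', u') \<in> (X - U) \<times> U \<Longrightarrow> travel (D v) (D u) \<le> travel (D v') (D u')"
    using ex_is_arg_min_if_finite[OF fin ne, of "\<lambda>(v, u). travel (D v) (D u)"]
    unfolding is_arg_min_linorder by auto
  have "D z \<notin> open_arc (D v) (D u)" if z: "z \<in> X" for z
  proof
    assume arc: "D z \<in> open_arc (D v) (D u)"
    have "D v \<in> circle" "D u \<in> circle"
      using vu U under_over_circle[OF D] by auto
    then have "travel (D v) (D z) < travel (D v) (D u)" "travel (D z) (D u) < travel (D v) (D u)"
      using arc travel_less_left travel_less_right by auto
    then show False
      using min[of v z] min[of z u] vu z by (cases "z \<in> U") auto
  qed
  then have "consecutive D v u"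
    using vu U by (auto simp: consecutive_def)
  then show thesis
    using that vu by auto
qed


section \<open>Overcrossings in a common gap\<close>

definition leads :: "(real^2 \<Rightarrow> complex) \<Rightarrow> real^2 \<Rightarrow> real^2 \<Rightarrow> bool" where
  "leads W x y \<longleftrightarrow> neighbours (flip {x} W) x y"

lemma leads_exists:
  assumes "W \<in> diagrams \<gamma>" "x \<in> X" "X \<noteq> {x}"
  shows "\<exists>y. leads W x y"
proof -
  have "flip {x} W \<in> diagrams \<gamma>" "{x} \<subseteq> X" "{x} \<noteq> {}" "{x} \<noteq> X"
    using assms by auto
  then obtain u v where "u \<in> {x}" "consecutive (flip {x} W) v u"
    by (rule neighbours_on_boundary)
  then show ?thesis
    by (auto simp: leads_def neighbours_def)
qed

text \<open>
  Send each \<open>r\<close> in \<open>R\<close> to the crossing whose undercrossing is the first one after the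
  overcrossing of \<open>r\<close>. This maps \<open>R\<close> to itself. If it were injective, it would be onto, so the gap
  before every undercrossing of \<open>R\<close> would contain an overcrossing of \<open>R\<close>; but at a place where \<open>R\<close>
  is entered from outside, the crossing of such an overcrossing leads out of \<open>R\<close>. Hence two
  overcrossings of \<open>R\<close> share a gap.
\<close>

lemma neighbours_in_closed_set:
  assumes W: "W \<in> diagrams \<gamma>" and R: "R \<subseteq> X" "R \<noteq> {}" "R \<noteq> X"
    and closed: "\<And>x y. x \<in> R \<Longrightarrow> leads W x y \<Longrightarrow> y \<in> R"
  obtains r s where "r \<in> R" "s \<in> R" "r \<noteq> s" "neighbours (flip {r, s} W) r s"
proof -
  have circ: "W x \<in> circle" "over W x \<in> circle" if "x \<in> X" for x
    using under_over_circle[OF W that] by auto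
  have over_neq: "over W x \<noteq> W y" if "x \<in> X" "y \<in> X" for x y
    using under_over_circle(3,4)[OF W] preimages_under_over(2)[OF W] that by metis
  have "\<exists>u\<in>X. \<forall>z\<in>X. travel (over W r) (W u) \<le> travel (over W r) (W z)" for r
    using ex_is_arg_min_if_finite[OF finite_crossings, of "\<lambda>u. travel (over W r) (W u)"] R
    unfolding is_arg_min_linorder by auto
  then obtain nxt where nxt: "nxt r \<in> X"
    "\<And>z. z \<in> X \<Longrightarrow> travel (over W r) (W (nxt r)) \<le> travel (over W r) (W z)" for r
    by metis
  have free: "W z \<notin> open_arc (over W r) (W (nxt r))" if "z \<in> X" for z r
    using nxt(2)[OF that, of r] by (auto simp: open_arc_def)
  \<comment> \<open>The next undercrossing may be that of \<open>r\<close> itself, which moves away when \<open>r\<close> is switched;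
    then \<open>r\<close> does not lead to it, but it lies in \<open>R\<close> anyway.\<close>
  have nxt_R: "nxt r \<in> R" if r: "r \<in> R" for r
  proof (cases "nxt r = r")
    case False
    have "flip {r} W z \<notin> open_arc (over W r) (W (nxt r))" if "z \<in> X" for z
      using free[OF that, of r] that circ by (cases "z = r") (auto simp: flip_apply)
    moreover have "flip {r} W r = over W r" "flip {r} W (nxt r) = W (nxt r)"
      using False r R nxt(1)[of r] by (auto simp: flip_apply)
    ultimately have "consecutive (flip {r} W) r (nxt r)"
      using False r R nxt(1)[of r] by (auto simp: consecutive_def)
    then show ?thesis
      using closed[OF r] by (auto simp: leads_def neighbours_def)
  qed (use r in auto)
  have "\<not> inj_on nxt R"
  proof
    assume "inj_on nxt R"
    then have onto: "nxt ` R = R"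
      using endo_inj_surj[of R nxt] nxt_R finite_crossings R(1) finite_subset by blast
    obtain u v where uv: "u \<in> R" "v \<in> X - R" "consecutive W v u"
      using neighbours_on_boundary[OF W R] .
    obtain r where r: "r \<in> R" "u = nxt r"
      using onto uv(1) by blast
    have X: "r \<in> X" "u \<in> X" "v \<in> X" "r \<noteq> v" "u \<noteq> v"
      using r uv R by auto
    have "W v \<noteq> W u"
      using under_over_circle(3)[OF W] X by metis
    then have "over W r \<in> open_arc (W v) (W u)"
      using open_arc_dichotomy[of "W v" "over W r" "W u"] circ X over_neq free[of v r] r(2) by metis
    then have sub: "open_arc (W v) (over W r) \<subseteq> open_arc (W v) (W u)"
      by (rule open_arc_initial)
    have "flip {r} W z \<notin> open_arc (W v) (over W r)" if "z \<in> X" for z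
      using sub uv(3) that circ X by (auto simp: flip_apply consecutive_def)
    then have "consecutive (flip {r} W) v r"
      using X by (auto simp: consecutive_def flip_apply)
    then show False
      using closed[OF r(1)] uv(2) by (auto simp: leads_def neighbours_def)
  qed
  then obtain r s where rs: "r \<in> R" "s \<in> R" "r \<noteq> s" "nxt r = nxt s"
    by (auto simp: inj_on_def)
  have consec: "consecutive (flip {r, s} W) r s"
    if "r \<in> X" "s \<in> X" "r \<noteq> s" "over W s \<in> open_arc (over W r) (W (nxt r))" for r s
  proof -
    have "flip {r, s} W z \<notin> open_arc (over W r) (over W s)" if "z \<in> X" for z
      using open_arc_initial that free[of z r] circ \<open>r \<in> X\<close> \<open>over W s \<in> _\<close>
      by (auto simp: flip_apply)
    then show ?thesis
      using that by (auto simp: consecutive_def flip_apply)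
  qed
  have X: "r \<in> X" "s \<in> X"
    using rs R by auto
  then have "over W r \<noteq> over W s"
    using under_over_circle(4)[OF W] rs(3) by metis
  then have "over W s \<in> open_arc (over W r) (W (nxt r)) \<or> over W r \<in> open_arc (over W s) (W (nxt r))"
    using open_arc_dichotomy[of "over W r" "over W s" "W (nxt r)"] circ over_neq X nxt(1) by metis
  then have "neighbours (flip {r, s} W) r s"
    using consec[of r s] consec[of s r] rs X by (auto simp: neighbours_def insert_commute)
  with rs that show thesis by blast
qed

section \<open>Sets of diagrams closed under predecessors\<close>

definition predecessor_closed :: "(real^2 \<Rightarrow> complex) set \<Rightarrow> bool" where
  "predecessor_closed \<B> \<longleftrightarrow>
     \<B> \<subseteq> diagrams \<gamma> \<and> (\<forall>E. \<forall>F\<in>\<B>. arc_crossing_change \<gamma> E F \<longrightarrow> E \<in> \<B>)"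

definition separated ::
  "(real^2 \<Rightarrow> complex) set \<Rightarrow> (real^2 \<Rightarrow> complex) \<Rightarrow> real^2 \<Rightarrow> (real^2) set" where
  "separated \<B> W x = {y \<in> X. y \<noteq> x \<and> flip {x, y} W \<notin> \<B>}"

lemma separated_sym: "x \<in> X \<Longrightarrow> y \<in> separated \<B> W x \<Longrightarrow> x \<in> separated \<B> W y"
  by (auto simp: separated_def insert_commute)

text \<open>
  Outside \<open>\<B>\<close> every arc crossing change stays outside. Apply this to the diagram in which \<open>k\<close> and
  \<open>c\<close> are flipped: \<open>k\<close> is still next to \<open>e\<close> there, unless \<open>c\<close> has come in between and is itself
  next to \<open>k\<close>. The latter is impossible, because switching \<open>k\<close> and \<open>c\<close> once more gives \<open>W\<close>, which
  is in \<open>\<B>\<close>.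
\<close>

lemma separated_leads:
  assumes \<B>: "predecessor_closed \<B>"
    and W: "W \<in> \<B>" and ke: "leads W k e" and c: "c \<in> separated \<B> W k" "c \<noteq> e"
  shows "c \<in> separated \<B> W e"
proof -
  have Wd: "W \<in> diagrams \<gamma>"
    using W \<B> by (auto simp: predecessor_closed_def)
  have X: "k \<in> X" "e \<in> X" "k \<noteq> e" and cX: "c \<in> X" "c \<noteq> k"
    using ke neighboursD c by (auto simp: leads_def separated_def)
  define D where "D = flip {k, c} W"
  have D: "D \<in> diagrams \<gamma>" "D \<notin> \<B>"
    using Wd c(1) by (auto simp: D_def separated_def)
  have stay: "flip {x, y} D \<notin> \<B>" if "neighbours D x y" for x y
    using \<B> D that arc_crossing_change_iff[OF D(1)] unfolding predecessor_closed_def by blast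
  have "D = flip {c} (flip {k} W)"
    using Wd cX(2) by (auto simp: D_def flip_flip insert_commute)
  then have "neighbours D k e \<or> neighbours D k c"
    using neighbours_flip_other[of "flip {k} W" k e c] ke Wd cX c(2) by (simp add: leads_def)
  moreover have "\<not> neighbours D k c"
    using stay[of k c] W flip_twice[OF Wd] by (auto simp: D_def)
  ultimately have "flip {k, e} D \<notin> \<B>"
    using stay by blast
  moreover have "sym_diff {k, e} {k, c} = {e, c}"
    using X cX c(2) by auto
  ultimately show ?thesis
    using cX c(2) Wd by (simp add: D_def flip_flip separated_def)
qed

text \<open>
  The hypothesis that no member is isolated cannot be dropped: if \<open>T\<close> is a source, then \<open>{T}\<close> is
  closed under predecessors.
\<close>

lemma predecessor_closed_imp_flip_closed:
  assumes \<B>: "predecessor_closed \<B>"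
    and not_isolated: "\<And>W. W \<in> \<B> \<Longrightarrow> \<exists>x\<in>X. \<exists>y\<in>X. x \<noteq> y \<and> flip {x, y} W \<in> \<B>"
    and V: "V \<in> \<B>" and ij: "i \<in> X" "j \<in> X" "i \<noteq> j"
  shows "flip {i, j} V \<in> \<B>"
proof (rule ccontr)
  assume bad: "flip {i, j} V \<notin> \<B>"
  have Vd: "V \<in> diagrams \<gamma>"
    using V \<B> by (auto simp: predecessor_closed_def)
  \<comment> \<open>Both \<open>V\<close> and the diagram with \<open>i\<close> and \<open>j\<close> flipped arise from \<open>Y\<close> by one flip. Colouring the
    crossings of \<open>Y\<close> by whether their flip lands in \<open>\<B>\<close>, both colours occur, hence somewhere on
    consecutive undercrossings.\<close>
  define Y where "Y = flip {j} V"
  define U where "U = {z \<in> X. flip {z} Y \<notin> \<B>}"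
  have Y: "Y \<in> diagrams \<gamma>"
    using Vd by (simp add: Y_def)
  have "flip {j} Y = V"
    using Vd by (simp add: Y_def flip_twice)
  moreover have "flip {i} Y = flip {i, j} V"
    using Vd ij(3) by (simp add: Y_def flip_flip insert_commute insert_Diff_if)
  ultimately have "i \<in> U" "j \<notin> U" "U \<subseteq> X"
    using V bad ij by (auto simp: U_def)
  then obtain a b where ab: "a \<in> U" "b \<in> X - U" "consecutive Y b a"
    using neighbours_on_boundary[OF Y, of U] ij by blast
  have abX: "a \<in> X" "b \<in> X" "a \<noteq> b"
    using ab by (auto simp: U_def)
  define W where "W = flip {b} Y"
  have W: "W \<in> \<B>" and Wd: "W \<in> diagrams \<gamma>"
    using ab(2) Y by (auto simp: W_def U_def)
  have Yb: "flip {b} W = Y"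
    using Y by (simp add: W_def flip_twice)
  let ?N = "separated \<B> W"
  have N_mono: "?N x - {y} \<subseteq> ?N y" if "leads W x y" for x y
    using separated_leads[OF \<B> W that] by auto
  have "leads W b a"
    using ab(3) by (simp add: leads_def neighbours_def Yb)
  moreover have "flip {b, a} W = flip {a} Y"
    using Y abX by (simp add: W_def flip_flip insert_Diff_if)
  then have "a \<in> ?N b"
    using ab(1) abX by (simp add: separated_def U_def)
  ultimately have start: "leads W b a \<and> a \<in> ?N b" ..

  define good where "good x \<longleftrightarrow> (\<exists>y. leads W x y \<and> y \<in> ?N x)" for x
  define hood where "hood x = insert x (?N x)" for x
  have leadsX: "x \<in> X" "y \<in> X" "x \<noteq> y" if "leads W x y" for x y
    using that neighboursD by (auto simp: leads_def)
  have hood_mono: "hood x \<subseteq> hood y" if "leads W x y" "y \<in> ?N x" for x y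
    using N_mono[OF that(1)] separated_sym[OF leadsX(1)[OF that(1)] that(2)] by (auto simp: hood_def)
  \<comment> \<open>A step to a separated crossing is followed only by steps to separated crossings: separation of
    \<open>x\<close> and \<open>y\<close> transfers along \<open>y\<close> to \<open>z\<close>, and separation of \<open>x\<close> and \<open>z\<close> back along \<open>x\<close> to \<open>y\<close>.\<close>
  have leads_N: "z \<in> ?N y" if xy: "leads W x y" "y \<in> ?N x" and yz: "leads W y z" for x y z
  proof (cases "z = x")
    case True
    then show ?thesis
      using separated_sym xy leadsX(1) by auto
  next
    case False
    then have "x \<in> ?N z"
      using N_mono[OF yz] separated_sym[OF leadsX(1)[OF xy(1)] xy(2)] by auto
    then have "z \<in> ?N x"
      using separated_sym leadsX(2)[OF yz] by auto
    then show ?thesis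
      using N_mono[OF xy(1)] leadsX(3)[OF yz] by auto
  qed
  have finite_hood: "finite (hood x)" for x
    using finite_crossings by (simp add: hood_def separated_def)
  have "{x. good x} \<subseteq> X"
    using leadsX(1) by (auto simp: good_def)
  then have fin: "finite ((\<lambda>x. card (hood x)) ` {x. good x})" (is "finite ?sizes")
    by (intro finite_imageI) (rule finite_subset[OF _ finite_crossings])
  have "?sizes \<noteq> {}"
    using start by (auto simp: good_def)
  then obtain m where "good m" "Max ?sizes = card (hood m)"
    using Max_in[OF fin] by auto
  then have m: "good m" "good x \<Longrightarrow> card (hood x) \<le> card (hood m)" for x
    using Max_ge[OF fin, of "card (hood x)"] by auto
  have hood_max: "hood x = hood m" if "good x" "hood m \<subseteq> hood x" for x
    using card_seteq[OF finite_hood that(2)] m(2)[OF that(1)] by simp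

  have other: "X \<noteq> {x}" for x
    using ij by auto
  \<comment> \<open>Members of \<open>R\<close> share one closed neighbourhood, which contains each of them; so \<open>R\<close> is
    pairwise separated.\<close>
  define R where "R = {x \<in> X. (\<forall>y. leads W x y \<longrightarrow> y \<in> ?N x) \<and> hood x = hood m}"
  have enter: "y \<in> R" if xy: "leads W x y" "y \<in> ?N x" and x: "hood x = hood m" for x y
  proof -
    have all: "\<forall>z. leads W y z \<longrightarrow> z \<in> ?N y"
      using leads_N[OF xy] by blast
    then have "good y"
      using leads_exists[OF Wd leadsX(2)[OF xy(1)] other] by (auto simp: good_def)
    then have "hood y = hood m"
      using hood_max hood_mono[OF xy] x by simp
    with all show ?thesis
      using leadsX(2)[OF xy(1)] by (simp add: R_def)
  qed
  have clique: "flip {x, y} W \<notin> \<B>" if "x \<in> R" "y \<in> R" "x \<noteq> y" for x y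
  proof -
    have "y \<in> hood x"
      using that by (auto simp: R_def hood_def)
    then show ?thesis
      using that(3) by (auto simp: hood_def separated_def)
  qed
  have "R \<noteq> {}"
    using m(1) enter by (auto simp: good_def)
  have "R = X"
  proof (rule ccontr)
    assume "R \<noteq> X"
    moreover have "y \<in> R" if "x \<in> R" "leads W x y" for x y
      using enter[of x y] that unfolding R_def by blast
    moreover have "R \<subseteq> X"
      by (auto simp: R_def)
    ultimately obtain r s where rs: "r \<in> R" "s \<in> R" "r \<noteq> s" "neighbours (flip {r, s} W) r s"
      using neighbours_in_closed_set[OF Wd _ \<open>R \<noteq> {}\<close>] by blast
    then have "arc_crossing_change \<gamma> (flip {r, s} W) (flip {r, s} (flip {r, s} W))"
      using arc_crossing_change_iff[OF flip_diagram[OF Wd]] by blast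
    then have "flip {r, s} W \<in> \<B>"
      using \<B> W unfolding predecessor_closed_def flip_twice[OF Wd] by blast
    then show False
      using clique[OF rs(1-3)] by contradiction
  qed
  then show False
    using not_isolated[OF W] clique by blast
qed

section \<open>Reachability\<close>

lemma flip_closed_imp_even_difference:
  assumes \<B>: "\<B> \<subseteq> diagrams \<gamma>"
    and flip: "\<And>V i j. V \<in> \<B> \<Longrightarrow> i \<in> X \<Longrightarrow> j \<in> X \<Longrightarrow> i \<noteq> j \<Longrightarrow> flip {i, j} V \<in> \<B>"
  shows "V \<in> \<B> \<Longrightarrow> S \<subseteq> X \<Longrightarrow> even (card S) \<Longrightarrow> flip S V \<in> \<B>"
proof (induction "card S" arbitrary: S V rule: less_induct)
  case less
  have Vd: "V \<in> diagrams \<gamma>"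
    using less.prems \<B> by auto
  have finS: "finite S"
    using less.prems(2) finite_crossings finite_subset by auto
  show ?case
  proof (cases "S = {}")
    case True
    then show ?thesis
      using less.prems(1) Vd by (simp add: flip_empty)
  next
    case False
    then obtain i where i: "i \<in> S" by blast
    have "S \<noteq> {i}"
      using less.prems(3) by auto
    then obtain j where j: "j \<in> S" "j \<noteq> i"
      using i by blast
    have "card {i, j} = 2" "{i, j} \<subseteq> S"
      using i j by auto
    then have card: "card (S - {i, j}) = card S - 2" "card S \<ge> 2"
      using finS by (metis card_Diff_subset finite.emptyI finite.insertI, metis card_mono)
    have "flip (S - {i, j}) (flip {i, j} V) \<in> \<B>"
    proof (rule less.hyps)
      show "flip {i, j} V \<in> \<B>"
        using flip[OF less.prems(1)] i j less.prems(2) by auto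
      show "card (S - {i, j}) < card S" "even (card (S - {i, j}))"
        using card less.prems(3) by auto
    qed (use less.prems(2) in auto)
    moreover have "sym_diff (S - {i, j}) {i, j} = S"
      using i j by auto
    ultimately show ?thesis
      using Vd by (simp add: flip_flip)
  qed
qed

lemma arc_crossing_change_cases:
  assumes "arc_crossing_change \<gamma> D E"
  obtains x y where "x \<in> X" "y \<in> X" "x \<noteq> y" "D \<in> diagrams \<gamma>" "E = flip {x, y} D"
proof -
  have "D \<in> diagrams \<gamma>"
    using assms by (simp add: arc_crossing_change_def)
  then show thesis
    using that assms arc_crossing_change_iff neighboursD by blast
qed

lemma reachable_diagram_parity:
  assumes "(arc_crossing_change \<gamma>)\<^sup>*\<^sup>* D E" "D \<in> diagrams \<gamma>" "b \<in> circle"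
  shows "E \<in> diagrams \<gamma> \<and> state_parity \<gamma> b D = state_parity \<gamma> b E"
  using assms(1)
proof (induction rule: rtranclp_induct)
  case (step E F)
  then obtain x y where "x \<in> X" "y \<in> X" "x \<noteq> y" "F = flip {x, y} E"
    by (auto elim: arc_crossing_change_cases)
  then show ?case
    using step.IH state_parity_flip[OF assms(3), of E "{x, y}"] by simp
qed (use assms in simp)

theorem reachable_iff_parity_and_not_source:
  assumes b: "b \<in> circle" and D: "D \<in> diagrams \<gamma>" and T: "T \<in> diagrams \<gamma>" and "T \<noteq> D"
  shows "(arc_crossing_change \<gamma>)\<^sup>*\<^sup>* D T \<longleftrightarrow>
    state_parity \<gamma> b D = state_parity \<gamma> b T \<and> \<not> is_source \<gamma> T"
proof
  assume r: "(arc_crossing_change \<gamma>)\<^sup>*\<^sup>* D T"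
  then obtain E where E: "(arc_crossing_change \<gamma>)\<^sup>*\<^sup>* D E" "arc_crossing_change \<gamma> E T"
    using \<open>T \<noteq> D\<close> by (auto elim: rtranclp.cases)
  then obtain x y where "x \<in> X" "E \<in> diagrams \<gamma>" "T = flip {x, y} E"
    by (auto elim: arc_crossing_change_cases)
  then have "E \<noteq> T"
    using flip_neq[of E x "{x, y}"] by auto
  with E(2) \<open>E \<in> diagrams \<gamma>\<close> have "\<not> is_source \<gamma> T"
    by (auto simp: is_source_def)
  then show "state_parity \<gamma> b D = state_parity \<gamma> b T \<and> \<not> is_source \<gamma> T"
    using reachable_diagram_parity[OF r D b] by simp
next
  assume asm: "state_parity \<gamma> b D = state_parity \<gamma> b T \<and> \<not> is_source \<gamma> T"
  then obtain E where E: "arc_crossing_change \<gamma> E T"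
    using T by (auto simp: is_source_def)
  define \<B> where "\<B> = {V \<in> diagrams \<gamma>. (arc_crossing_change \<gamma>)\<^sup>*\<^sup>* V T}"
  have TB: "T \<in> \<B>"
    using T by (simp add: \<B>_def)
  have not_isolated: "\<exists>x\<in>X. \<exists>y\<in>X. x \<noteq> y \<and> flip {x, y} W \<in> \<B>" if W: "W \<in> \<B>" for W
  proof (cases "W = T")
    case True
    from E obtain x y where xy: "x \<in> X" "y \<in> X" "x \<noteq> y" "E \<in> diagrams \<gamma>" "T = flip {x, y} E"
      by (rule arc_crossing_change_cases)
    then have "flip {x, y} W = E"
      using True flip_twice by simp
    then show ?thesis
      using xy E by (auto simp: \<B>_def)
  next
    case False
    then obtain V where V: "arc_crossing_change \<gamma> W V" "(arc_crossing_change \<gamma>)\<^sup>*\<^sup>* V T"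
      using W by (auto simp: \<B>_def elim: converse_rtranclpE)
    from V(1) obtain x y where "x \<in> X" "y \<in> X" "x \<noteq> y" "W \<in> diagrams \<gamma>" "V = flip {x, y} W"
      by (rule arc_crossing_change_cases)
    then show ?thesis
      using V(2) by (auto simp: \<B>_def)
  qed
  have "predecessor_closed \<B>"
    by (auto simp: \<B>_def predecessor_closed_def elim: arc_crossing_change_cases
        intro: converse_rtranclp_into_rtranclp)
  then have "flip {i, j} V \<in> \<B>" if "V \<in> \<B>" "i \<in> X" "j \<in> X" "i \<noteq> j" for V i j
    using predecessor_closed_imp_flip_closed not_isolated that by blast
  moreover define S where "S = {x \<in> X. T x \<noteq> D x}"
  have "even (card S)"
    using asm state_parity_flip[OF b T, of S] flip_difference[OF T D] by (auto simp: S_def)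
  ultimately have "flip S T \<in> \<B>"
    using flip_closed_imp_even_difference[of \<B> T S] TB by (auto simp: \<B>_def S_def)
  then show "(arc_crossing_change \<gamma>)\<^sup>*\<^sup>* D T"
    using flip_difference[OF T D] by (simp add: \<B>_def S_def)
qed

end

theorem theorem1p1:
  fixes \<gamma> :: "complex \<Rightarrow> real^2" and b :: complex and D D' :: "real^2 \<Rightarrow> complex"
  assumes "knot_shadow \<gamma>" and "basepoint \<gamma> b"
    and "R1_reduced \<gamma> b"
    and "card (crossings \<gamma>) > 3"
    and "D \<in> diagrams \<gamma>" and "D' \<in> diagrams \<gamma>" and "D' \<noteq> D"
  shows "(arc_crossing_change \<gamma>)\<^sup>*\<^sup>* D D' \<longleftrightarrow>
           state_parity \<gamma> b D = state_parity \<gamma> b D' \<and> \<not> is_source \<gamma> D'"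
proof -
  interpret double_points \<gamma>
    using assms(1) by unfold_locales (auto simp: knot_shadow_def)
  show ?thesis
    using reachable_iff_parity_and_not_source[of b D D'] assms by (simp add: basepoint_def)
qed

end
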